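(* Among the flat Lie algebras on $\mathfrak g_{3,2}$ given in the list of the context: (i) none is associative; (ii) the Novikov ones are exactly $\mathfrak h_{0,2}^{\lambda=0},\mathfrak h_{0,5},\mathfrak h_{0,6}$; (iii) none is bi-symmetric; (iv) the complete ones are exactly $\mathfrak h_{0,2}^{\lambda=0},\mathfrak h_{0,4}$.
   Context: A flat Lie algebra is a real Lie algebra $\mathfrak g$ with a bilinear product $X\cdot Y=\nabla_XY$ such that $X\cdot Y-Y\cdot X=[X,Y]$ and $[X,Y]\cdot Z=X\cdot(Y\cdot Z)-Y\cdot(X\cdot Z)$. Put $R_X(Y)=Y\cdot X$ and $(X,Y,Z)=(X\cdot Y)\cdot Z-X\cdot(Y\cdot Z)$. It is associative if $(X,Y,Z)=0$ for all $X,Y,Z$; Novikov if $R_XR_Y=R_YR_X$ for all $X,Y$; bi-symmetric if $(X,Y,Z)=(X,Z,Y)$ for all $X,Y,Z$; complete if every $R_X$ is nilpotent. A superscript restricts the indicated parameter to the indicated value; parameters not mentioned take all admissible values. List on the Lie algebra $\mathfrak g_{3,2}$ with basis $e_1,e_2,e_3$ and nonzero brackets $[e_1,e_3]=e_1$, $[e_2,e_3]=e_1+e_2$ (only nonzero products $e_ie_j=e_i\cdot e_j$ given): $\mathfrak h_{0,1}$: $e_2e_2=\varepsilon e_3,\ e_3e_1=-e_1,\ e_3e_2=-e_1-e_2,\ e_3e_3=-2e_3$; $\varepsilon=\pm1$. $\mathfrak h_{0,2}$: $e_3e_1=-e_1,\ e_3e_2=-e_1-e_2,\ e_3e_3=\lambda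 e_3$; $\lambda\in\mathbb R$. $\mathfrak h_{0,3}$: $e_3e_1=-e_1,\ e_3e_2=-e_1-e_2,\ e_3e_3=e_2-e_3$. $\mathfrak h_{0,4}$: $e_2e_3=\lambda e_1,\ e_3e_1=-e_1,\ e_3e_2=(\lambda-1)e_1-e_2$; $\lambda\in\mathbb R\setminus\{0\}$. $\mathfrak h_{0,5}$: $e_1e_3=\lambda e_1,\ e_2e_3=\lambda e_2,\ e_3e_1=(\lambda-1)e_1,\ e_3e_2=-e_1+(\lambda-1)e_2,\ e_3e_3=\lambda e_3$; $\lambda\in\mathbb R\setminus\{0\}$. $\mathfrak h_{0,6}$: $e_1e_3=e_1,\ e_2e_3=e_2,\ e_3e_2=-e_1,\ e_3e_3=e_2+e_3$. $\mathfrak h_{2,1}$: $e_2e_2=e_1,\ e_2e_3=e_2,\ e_3e_1=-e_1,\ e_3e_2=-e_1,\ e_3e_3=-e_2+e_3$. $\mathfrak h_{2,2}$: $e_1e_3=-e_1,\ e_2e_2=e_1,\ e_3e_1=-2e_1,\ e_3e_2=-e_1-e_2,\ e_3e_3=-e_2-e_3$. *)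

theory Defs
  imports "HOL-Analysis.Analysis"
begin

definition lie_algebra :: "('a::real_vector \<Rightarrow> 'a \<Rightarrow> 'a) \<Rightarrow> bool" where
  "lie_algebra br \<longleftrightarrow> bilinear br \<and> (\<forall>X. br X X = 0) \<and>
     (\<forall>X Y Z. br X (br Y Z) + br Y (br Z X) + br Z (br X Y) = 0)"

definition flat_lie_algebra ::
    "('a::real_vector \<Rightarrow> 'a \<Rightarrow> 'a) \<Rightarrow> ('a \<Rightarrow> 'a \<Rightarrow> 'a) \<Rightarrow> bool" where
  "flat_lie_algebra br m \<longleftrightarrow> lie_algebra br \<and> bilinear m \<and>
     (\<forall>X Y. m X Y - m Y X = br X Y) \<and>
     (\<forall>X Y Z. m (br X Y) Z = m X (m Y Z) - m Y (m X Z))"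

definition right_mult :: "('a \<Rightarrow> 'a \<Rightarrow> 'a) \<Rightarrow> 'a \<Rightarrow> 'a \<Rightarrow> 'a" where
  "right_mult m X Y = m Y X"

definition associator :: "('a::real_vector \<Rightarrow> 'a \<Rightarrow> 'a) \<Rightarrow> 'a \<Rightarrow> 'a \<Rightarrow> 'a \<Rightarrow> 'a" where
  "associator m X Y Z = m (m X Y) Z - m X (m Y Z)"

definition nilpotent_map :: "('a::real_vector \<Rightarrow> 'a) \<Rightarrow> bool" where
  "nilpotent_map f \<longleftrightarrow> (\<exists>n. \<forall>x. (f ^^ n) x = 0)"

definition associative :: "('a::real_vector \<Rightarrow> 'a \<Rightarrow> 'a) \<Rightarrow> bool" where
  "associative m \<longleftrightarrow> (\<forall>X Y Z. associator m X Y Z = 0)"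

definition novikov :: "('a::real_vector \<Rightarrow> 'a \<Rightarrow> 'a) \<Rightarrow> bool" where
  "novikov m \<longleftrightarrow> (\<forall>X Y. right_mult m X \<circ> right_mult m Y = right_mult m Y \<circ> right_mult m X)"

definition bi_symmetric :: "('a::real_vector \<Rightarrow> 'a \<Rightarrow> 'a) \<Rightarrow> bool" where
  "bi_symmetric m \<longleftrightarrow> (\<forall>X Y Z. associator m X Y Z = associator m X Z Y)"

definition complete_product :: "('a::real_vector \<Rightarrow> 'a \<Rightarrow> 'a) \<Rightarrow> bool" where
  "complete_product m \<longleftrightarrow> (\<forall>X. nilpotent_map (right_mult m X))"

text \<open>In the numeral type \<open>3\<close> the index \<open>3\<close> coincides with \<open>0\<close>; the three indices are
  \<open>1\<close>, \<open>2\<close>, \<open>3\<close>.\<close>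

abbreviation ee :: "3 \<Rightarrow> real^3" where
  "ee i \<equiv> axis i 1"

text \<open>Bilinear extension of a multiplication table on the basis; absent entries are zero.\<close>

definition bilinear_ext :: "((3 \<times> 3) \<times> (real^3)) list \<Rightarrow> real^3 \<Rightarrow> real^3 \<Rightarrow> real^3" where
  "bilinear_ext T X Y = (\<Sum>i\<in>UNIV. \<Sum>j\<in>UNIV. (X $ i * Y $ j) *\<^sub>R
     (case map_of T (i, j) of None \<Rightarrow> 0 | Some v \<Rightarrow> v))"

text \<open>The table lists the brackets \<open>[e\<^sub>i, e\<^sub>j]\<close> with \<open>i < j\<close>; the others follow by antisymmetry.\<close>

definition bracket_g32 :: "real^3 \<Rightarrow> real^3 \<Rightarrow> real^3" where
  "bracket_g32 X Y =
     (let b = bilinear_ext [((1,3), ee 1), ((2,3), ee 1 + ee 2)] in b X Y - b Y X)"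

text \<open>\<open>Hij\<close> stands for \<open>\<hh>\<^sub>i\<^sub>,\<^sub>j\<close>.
  The argument is the parameter \<open>\<epsilon>\<close> (for \<open>H01\<close>) or \<open>\<lambda>\<close>.\<close>

datatype g32_label =
  H01 real | H02 real | H03 | H04 real | H05 real | H06 | H21 | H22

fun admissible :: "g32_label \<Rightarrow> bool" where
  "admissible (H01 \<epsilon>) \<longleftrightarrow> \<epsilon> = 1 \<or> \<epsilon> = -1"
| "admissible (H04 l) \<longleftrightarrow> l \<noteq> 0"
| "admissible (H05 l) \<longleftrightarrow> l \<noteq> 0"
| "admissible _ \<longleftrightarrow> True"

definition g32_list :: "g32_label set" where
  "g32_list = {h. admissible h}"

fun table :: "g32_label \<Rightarrow> ((3 \<times> 3) \<times> (real^3)) list" where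
  "table (H01 \<epsilon>) = [((2,2), \<epsilon> *\<^sub>R ee 3), ((3,1), - ee 1), ((3,2), - ee 1 - ee 2), ((3,3), -2 *\<^sub>R ee 3)]"
| "table (H02 l) = [((3,1), - ee 1), ((3,2), - ee 1 - ee 2), ((3,3), l *\<^sub>R ee 3)]"
| "table H03 = [((3,1), - ee 1), ((3,2), - ee 1 - ee 2), ((3,3), ee 2 - ee 3)]"
| "table (H04 l) = [((2,3), l *\<^sub>R ee 1), ((3,1), - ee 1), ((3,2), (l - 1) *\<^sub>R ee 1 - ee 2)]"
| "table (H05 l) = [((1,3), l *\<^sub>R ee 1), ((2,3), l *\<^sub>R ee 2), ((3,1), (l - 1) *\<^sub>R ee 1),
     ((3,2), - ee 1 + (l - 1) *\<^sub>R ee 2), ((3,3), l *\<^sub>R ee 3)]"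
| "table H06 = [((1,3), ee 1), ((2,3), ee 2), ((3,2), - ee 1), ((3,3), ee 2 + ee 3)]"
| "table H21 = [((2,2), ee 1), ((2,3), ee 2), ((3,1), - ee 1), ((3,2), - ee 1), ((3,3), - ee 2 + ee 3)]"
| "table H22 = [((1,3), - ee 1), ((2,2), ee 1), ((3,1), -2 *\<^sub>R ee 1), ((3,2), - ee 1 - ee 2),
     ((3,3), - ee 2 - ee 3)]"

definition product :: "g32_label \<Rightarrow> real^3 \<Rightarrow> real^3 \<Rightarrow> real^3" where
  "product h = bilinear_ext (table h)"

lemma bilinear_bilinear_ext: "bilinear (bilinear_ext T)"
  unfolding bilinear_def
  by (auto intro!: linearI simp: bilinear_ext_def sum.distrib algebra_simps scaleR_sum_right)

lemma bilinear_ext_basis: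
  "bilinear_ext T (ee i) (ee j) = (case map_of T (i, j) of None \<Rightarrow> 0 | Some v \<Rightarrow> v)"
proof -
  have "bilinear_ext T (ee i) (ee j) =
      (\<Sum>k\<in>UNIV. \<Sum>l\<in>UNIV. if l = j then if k = i
         then (case map_of T (k, l) of None \<Rightarrow> 0 | Some v \<Rightarrow> v) else 0 else 0)"
    unfolding bilinear_ext_def by (intro sum.cong refl) (auto simp: axis_def)
  then show ?thesis by simp
qed

lemma lie_algebra_bracket_g32: "lie_algebra bracket_g32"
  unfolding lie_algebra_def bilinear_def
  by (auto intro!: linearI simp: bracket_g32_def Let_def bilinear_ext_def sum_3 vec_eq_iff
      forall_3 axis_def algebra_simps)

lemma flat_lie_algebra_product:
  assumes "h \<in> g32_list"
  shows "flat_lie_algebra bracket_g32 (product h)"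
  using assms lie_algebra_bracket_g32
  unfolding g32_list_def flat_lie_algebra_def product_def
  by (cases h) (auto simp: bilinear_bilinear_ext bracket_g32_def Let_def bilinear_ext_def sum_3
      vec_eq_iff forall_3 axis_def algebra_simps)

end

(* Everything is decided by a few products.  The associators (e3,e3,e2) and (e3,e2,e3) differ for
   every member of the list, which excludes bi-symmetry and hence associativity.  Right
   multiplications by e2 and e3 commute on e3 only for the algebras claimed to be Novikov.
   Right multiplication by e3 has a nonzero real eigenvalue unless the algebra is one of those
   claimed to be complete, where all triple products ((YX)X)X vanish. *)
theory Submission
  imports Defs
begin

text \<open>Expanding the tables once into coordinates turns every later claim about products into
  polynomial identities over the reals.\<close>

lemma product_nth:
  fixes X Y :: "real^3"
  shows
    "product (H01 \<epsilon>) X Y $ 1 = - (X $ 3 * Y $ 1) - X $ 3 * Y $ 2"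
    "product (H01 \<epsilon>) X Y $ 2 = - (X $ 3 * Y $ 2)"
    "product (H01 \<epsilon>) X Y $ 3 = \<epsilon> * (X $ 2 * Y $ 2) - 2 * (X $ 3 * Y $ 3)"
    "product (H02 l) X Y $ 1 = - (X $ 3 * Y $ 1) - X $ 3 * Y $ 2"
    "product (H02 l) X Y $ 2 = - (X $ 3 * Y $ 2)"
    "product (H02 l) X Y $ 3 = l * (X $ 3 * Y $ 3)"
    "product H03 X Y $ 1 = - (X $ 3 * Y $ 1) - X $ 3 * Y $ 2"
    "product H03 X Y $ 2 = X $ 3 * Y $ 3 - X $ 3 * Y $ 2"
    "product H03 X Y $ 3 = - (X $ 3 * Y $ 3)"
    "product (H04 l) X Y $ 1 = l * (X $ 2 * Y $ 3) - X $ 3 * Y $ 1 + (l - 1) * (X $ 3 * Y $ 2)"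
    "product (H04 l) X Y $ 2 = - (X $ 3 * Y $ 2)"
    "product (H04 l) X Y $ 3 = 0"
    "product (H05 l) X Y $ 1 = l * (X $ 1 * Y $ 3) + (l - 1) * (X $ 3 * Y $ 1) - X $ 3 * Y $ 2"
    "product (H05 l) X Y $ 2 = l * (X $ 2 * Y $ 3) + (l - 1) * (X $ 3 * Y $ 2)"
    "product (H05 l) X Y $ 3 = l * (X $ 3 * Y $ 3)"
    "product H06 X Y $ 1 = X $ 1 * Y $ 3 - X $ 3 * Y $ 2"
    "product H06 X Y $ 2 = X $ 2 * Y $ 3 + X $ 3 * Y $ 3"
    "product H06 X Y $ 3 = X $ 3 * Y $ 3"
    "product H21 X Y $ 1 = X $ 2 * Y $ 2 - X $ 3 * Y $ 1 - X $ 3 * Y $ 2"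
    "product H21 X Y $ 2 = X $ 2 * Y $ 3 - X $ 3 * Y $ 3"
    "product H21 X Y $ 3 = X $ 3 * Y $ 3"
    "product H22 X Y $ 1 = X $ 2 * Y $ 2 - X $ 1 * Y $ 3 - 2 * (X $ 3 * Y $ 1) - X $ 3 * Y $ 2"
    "product H22 X Y $ 2 = - (X $ 3 * Y $ 2) - X $ 3 * Y $ 3"
    "product H22 X Y $ 3 = - (X $ 3 * Y $ 3)"
  by (simp_all add: product_def bilinear_ext_def sum_3 axis_def algebra_simps)

lemmas product_coords = product_nth vec_eq_iff forall_3 axis_def

lemma associative_imp_bi_symmetric: "associative m \<Longrightarrow> bi_symmetric m"
  by (simp add: associative_def bi_symmetric_def)

lemma novikov_iff: "novikov m \<longleftrightarrow> (\<forall>X Y Z. m (m Z Y) X = m (m Z X) Y)"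
  by (simp add: novikov_def right_mult_def fun_eq_iff)

text \<open>Iterating gives \<open>(f ^^ n) v = c ^ n *\<^sub>R v\<close>, so a vanishing power of
  \<open>f\<close> forces \<open>c ^ n = 0\<close>.\<close>

lemma nilpotent_map_eigenvalue:
  fixes f :: "'a::real_vector \<Rightarrow> 'a"
  assumes "linear f" "nilpotent_map f" "f v = c *\<^sub>R v" "v \<noteq> 0"
  shows "c = 0"
proof -
  have "(f ^^ n) v = (c ^ n) *\<^sub>R v" for n
    by (induction n) (simp_all add: assms(3) linear_scale[OF assms(1)])
  moreover obtain n where "(f ^^ n) v = 0"
    using assms(2) by (auto simp: nilpotent_map_def)
  ultimately show ?thesis
    using assms(4) by simp
qed

lemma complete_product_eigenvalue:
  assumes "bilinear m" "complete_product m" "m v x = c *\<^sub>R v" "v \<noteq> 0"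
  shows "c = 0"
proof (rule nilpotent_map_eigenvalue)
  show "linear (right_mult m x)"
    using assms(1) by (simp add: bilinear_def right_mult_def[abs_def])
  show "nilpotent_map (right_mult m x)"
    using assms(2) by (simp add: complete_product_def)
  show "right_mult m x v = c *\<^sub>R v" "v \<noteq> 0"
    using assms(3,4) by (simp_all add: right_mult_def)
qed

text \<open>For linear maps on \<open>real^3\<close> the exponent 3 is no restriction: a nilpotent
  one has vanishing cube.\<close>

lemma complete_productI:
  assumes "\<And>X Y. m (m (m Y X) X) X = 0"
  shows "complete_product m"
  unfolding complete_product_def nilpotent_map_def
  using assms by (auto simp: right_mult_def numeral_3_eq_3 intro!: exI[of _ 3])

lemma bilinear_product: "bilinear (product h)"
  by (simp add: product_def bilinear_bilinear_ext)

lemma not_bi_symmetric_product: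
  assumes "admissible h"
  shows "\<not> bi_symmetric (product h)"
proof
  assume "bi_symmetric (product h)"
  then have "associator (product h) (ee 3) (ee 3) (ee 2) = associator (product h) (ee 3) (ee 2) (ee 3)"
    by (simp add: bi_symmetric_def)
  then show False
    \<comment> \<open>The right-hand side is 0 except for \<open>H21\<close> and \<open>H22\<close>,
      where the two sides are -3 e1 and e1. The left-hand side is nonzero throughout: for
      \<open>H02 l\<close> its coefficients are -(l+2) and -(l+1), for \<open>H05 l\<close> they are
      l-2 and l-1, and neither pair vanishes simultaneously.\<close>
    using assms by (cases h) (auto simp: associator_def product_coords)
qed

lemma novikov_product_iff:
  assumes "admissible h"
  shows "novikov (product h) \<longleftrightarrow> h \<in> {H02 0} \<union> {H05 l | l. l \<noteq> 0} \<union> {H06}"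
proof
  assume "novikov (product h)"
  then have "product h (product h (ee 3) (ee 3)) (ee 2) = product h (product h (ee 3) (ee 2)) (ee 3)"
    by (simp add: novikov_iff)
  then show "h \<in> {H02 0} \<union> {H05 l | l. l \<noteq> 0} \<union> {H06}"
    \<comment> \<open>For \<open>H02 l\<close> the equation reads -l (e1 + e2) = 0, which leaves l =
      0; for \<open>H04 l\<close> it reads 0 = -l e1, contrary to admissibility. It fails outright
      for \<open>H01\<close>, \<open>H03\<close>, \<open>H21\<close> and \<open>H22\<close>.\<close>
    using assms by (cases h) (auto simp: product_coords)
next
  assume "h \<in> {H02 0} \<union> {H05 l | l. l \<noteq> 0} \<union> {H06}"
  then show "novikov (product h)"
    \<comment> \<open>In all three families right multiplication by X is a scalar plus a map sending
      Z to \<open>Z $ 3\<close> times a vector of span(e1, e2). Any two maps of the latter kind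
      compose to 0, so the right multiplications commute.\<close>
    unfolding novikov_iff by (auto simp: product_coords algebra_simps)
qed

lemma complete_product_iff:
  assumes "admissible h"
  shows "complete_product (product h) \<longleftrightarrow> h \<in> {H02 0} \<union> {H04 l | l. l \<noteq> 0}"
proof
  assume complete: "complete_product (product h)"
  have eigenvalue: "c = 0" if "product h v (ee 3) = c *\<^sub>R v" "v \<noteq> 0" for c v
    using complete_product_eigenvalue[OF bilinear_product complete] that by blast
  show "h \<in> {H02 0} \<union> {H04 l | l. l \<noteq> 0}"
  proof (cases h)
    case (H01 \<epsilon>)
    then show ?thesis using eigenvalue[of "ee 3" "-2"] by (simp add: product_coords)
  next
    case (H02 l)
    \<comment> \<open>The eigenvalue is the parameter itself, so its vanishing is the claim here,
      not a contradiction.\<close>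
    then show ?thesis using eigenvalue[of "ee 3" l] by (simp add: product_coords)
  next
    case H03
    \<comment> \<open>Right multiplication by e3 kills e1 and e2, so its image is spanned by e3 e3 =
      e2 - e3, which is therefore the eigenvector.\<close>
    then show ?thesis using eigenvalue[of "ee 2 - ee 3" "-1"] by (simp add: product_coords)
  next
    case (H04 l)
    then show ?thesis using assms by simp
  next
    case (H05 l)
    then show ?thesis using assms eigenvalue[of "ee 1" l] by (simp add: product_coords)
  next
    case H06
    then show ?thesis using eigenvalue[of "ee 1" 1] by (simp add: product_coords)
  next
    case H21
    then show ?thesis using eigenvalue[of "ee 2" 1] by (simp add: product_coords)
  next
    case H22
    then show ?thesis using eigenvalue[of "ee 1" "-1"] by (simp add: product_coords)
  qed
next
  assume "h \<in> {H02 0} \<union> {H04 l | l. l \<noteq> 0}"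
  then show "complete_product (product h)"
    \<comment> \<open>Right multiplication by any X maps everything into span(e1, e2), that plane
      into span(e1), and e1 to 0.\<close>
    by (intro complete_productI) (auto simp: product_coords)
qed

theorem corollary4:
  shows "(\<forall>h\<in>g32_list. \<not> associative (product h)) \<and>
    {h \<in> g32_list. novikov (product h)} = {H02 0} \<union> {H05 l | l. l \<noteq> 0} \<union> {H06} \<and>
    (\<forall>h\<in>g32_list. \<not> bi_symmetric (product h)) \<and>
    {h \<in> g32_list. complete_product (product h)} = {H02 0} \<union> {H04 l | l. l \<noteq> 0}"
proof (intro conjI)
  show "\<forall>h\<in>g32_list. \<not> bi_symmetric (product h)"
    by (simp add: g32_list_def not_bi_symmetric_product)
  then show "\<forall>h\<in>g32_list. \<not> associative (product h)"
    using associative_imp_bi_symmetric by blast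
  show "{h \<in> g32_list. novikov (product h)} = {H02 0} \<union> {H05 l | l. l \<noteq> 0} \<union> {H06}"
    using novikov_product_iff by (auto simp: g32_list_def)
  show "{h \<in> g32_list. complete_product (product h)} = {H02 0} \<union> {H04 l | l. l \<noteq> 0}"
    using complete_product_iff by (auto simp: g32_list_def)
qed

end
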